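(* The bi-parameter Carleson condition implies the restricted energy condition: for every $C>0$ there is a constant $C'>0$ depending only on $C$ such that for every $N\ge1$ and every non-negative measure $\mu$ on $\partial T^2$ (with $T$ the dyadic tree of depth $N$) satisfying $$\sum_{R\in\mathcal R_E}\mu(R)^2\le C\,\mu(E)\qquad\text{for all }E\subset\partial T^2,$$ one has $$\mathcal E[\mu|E]\le C'\,\mu(E)\qquad\text{for all }E\subset\partial T^2.$$
   Context: $T$ is the finite dyadic tree of depth $N$: its nodes are the dyadic subintervals of $[0,1]$ of length $2^{-k}$, $0\le k\le N$; its boundary $\partial T$ is the set of dyadic intervals of length $2^{-N}$. The bi-tree is $T^2=T\times T$; a node $\alpha\in T^2$ is identified with the dyadic rectangle $R_\alpha\subset[0,1]^2$, and $\alpha\le\beta$ means $R_\alpha\subset R_\beta$. The boundary $\partial T^2=(\partial T)^2$ consists of the dyadic squares $\omega$ (also written $R_\omega$) of side $2^{-N}$. A measure $\mu$ on $\partial T^2$ assigns a finite mass $\mu(\omega)\ge0$ to each $\omega\in\partial T^2$. For a dyadic rectangle, $\mu(R_\alpha)=\sum_{\omega\in\partial T^2,\ \omega\le\alpha}\mu(\omega)$; for $E\subset\partial T^2$, $\mu(E)=\sum_{\omega\in E}\mu(\omega)$. The restriction $\mu|E$ is the measure with $(\mu|E)(\omega)=\mu(\omega)$ if $\omega\in E$ and $0$ otherwise. For $E\subset\partial T^2$, $U_E=\bigcup_{\omega\in E}R_\omega$ and $\mathcal R_E$ is the collection of all dyadic rectangles $R$ (nodes of $T^2$) with $R\subset U_E$.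 The energy of a measure $\nu$ is $\mathcal E[\nu]=\sum_{\alpha\in T^2}\nu(R_\alpha)^2$. *)

theory Defs
  imports Complex_Main
begin

text \<open>
  Nodes of the tree and of the bi-tree are represented by the (closed) dyadic intervals and
  rectangles they are identified with, so that the order on nodes is \<open>\<subseteq>\<close>.
\<close>

definition dyadic_interval :: "nat \<Rightarrow> nat \<Rightarrow> real set" where
  "dyadic_interval k j = {real j / 2 ^ k .. (real j + 1) / 2 ^ k}"

definition dyadic_tree :: "nat \<Rightarrow> real set set" where
  "dyadic_tree N = {dyadic_interval k j | k j. k \<le> N \<and> j < 2 ^ k}"

definition tree_boundary :: "nat \<Rightarrow> real set set" where
  "tree_boundary N = {dyadic_interval N j | j. j < 2 ^ N}"

definition bitree :: "nat \<Rightarrow> (real \<times> real) set set" where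
  "bitree N = {I \<times> J | I J. I \<in> dyadic_tree N \<and> J \<in> dyadic_tree N}"

definition bitree_boundary :: "nat \<Rightarrow> (real \<times> real) set set" where
  "bitree_boundary N = {I \<times> J | I J. I \<in> tree_boundary N \<and> J \<in> tree_boundary N}"

text \<open>
  A measure on the boundary is given by its point masses. It is a function on all sets, but
  only its values on \<open>bitree_boundary N\<close> are ever used. The mass of a collection \<open>E\<close> of boundary
  squares is \<open>sum \<mu> E\<close>, and \<open>rect_mass N \<mu> R\<close> is the mass of a rectangle.
\<close>

definition boundary_measure :: "nat \<Rightarrow> ((real \<times> real) set \<Rightarrow> real) \<Rightarrow> bool" where
  "boundary_measure N \<mu> \<longleftrightarrow> (\<forall>\<omega>\<in>bitree_boundary N. 0 \<le> \<mu> \<omega>)"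

definition rect_mass :: "nat \<Rightarrow> ((real \<times> real) set \<Rightarrow> real) \<Rightarrow> (real \<times> real) set \<Rightarrow> real" where
  "rect_mass N \<mu> R = (\<Sum>\<omega> | \<omega> \<in> bitree_boundary N \<and> \<omega> \<subseteq> R. \<mu> \<omega>)"

definition restrict_measure ::
    "((real \<times> real) set \<Rightarrow> real) \<Rightarrow> (real \<times> real) set set \<Rightarrow> (real \<times> real) set \<Rightarrow> real" where
  "restrict_measure \<mu> E = (\<lambda>\<omega>. if \<omega> \<in> E then \<mu> \<omega> else 0)"

definition rects_inside :: "nat \<Rightarrow> (real \<times> real) set set \<Rightarrow> (real \<times> real) set set" where
  "rects_inside N E = {R \<in> bitree N. R \<subseteq> \<Union>E}"

definition energy :: "nat \<Rightarrow> ((real \<times> real) set \<Rightarrow> real) \<Rightarrow> real" where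
  "energy N \<nu> = (\<Sum>R\<in>bitree N. (rect_mass N \<nu> R)\<^sup>2)"

definition carleson_condition :: "nat \<Rightarrow> ((real \<times> real) set \<Rightarrow> real) \<Rightarrow> real \<Rightarrow> bool" where
  "carleson_condition N \<mu> C \<longleftrightarrow>
     (\<forall>E \<subseteq> bitree_boundary N. (\<Sum>R\<in>rects_inside N E. (rect_mass N \<mu> R)\<^sup>2) \<le> C * sum \<mu> E)"

definition restricted_energy_condition ::
    "nat \<Rightarrow> ((real \<times> real) set \<Rightarrow> real) \<Rightarrow> real \<Rightarrow> bool" where
  "restricted_energy_condition N \<mu> C \<longleftrightarrow>
     (\<forall>E \<subseteq> bitree_boundary N. energy N (restrict_measure \<mu> E) \<le> C * sum \<mu> E)"

text \<open>The index sets are finite, so none of the sums above is zero by convention.\<close>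

lemma finite_dyadic_tree: "finite (dyadic_tree N)"
proof -
  have "dyadic_tree N \<subseteq> (\<lambda>(k, j). dyadic_interval k j) ` ({..N} \<times> {..<2 ^ N})"
  proof
    fix I assume "I \<in> dyadic_tree N"
    then obtain k j where kj: "I = dyadic_interval k j" "k \<le> N" "j < 2 ^ k"
      unfolding dyadic_tree_def by blast
    have "(2::nat) ^ k \<le> 2 ^ N" using kj(2) by (intro power_increasing) auto
    with kj(3) have "j < 2 ^ N" by linarith
    with kj(2) have "(k, j) \<in> {..N} \<times> {..<2 ^ N}" by auto
    then show "I \<in> (\<lambda>(k, j). dyadic_interval k j) ` ({..N} \<times> {..<2 ^ N})"
      using kj(1) by (force simp: image_iff)
  qed
  then show ?thesis by (rule finite_subset) auto
qed

lemma finite_bitree: "finite (bitree N)"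
proof -
  have "bitree N = (\<lambda>(I, J). I \<times> J) ` (dyadic_tree N \<times> dyadic_tree N)"
    unfolding bitree_def by auto
  then show ?thesis by (simp add: finite_dyadic_tree)
qed

lemma bitree_boundary_subset: "bitree_boundary N \<subseteq> bitree N"
  unfolding bitree_boundary_def bitree_def tree_boundary_def dyadic_tree_def by blast

lemma finite_bitree_boundary: "finite (bitree_boundary N)"
  using bitree_boundary_subset finite_bitree by (rule finite_subset)

end

theory Submission
  imports Defs
begin

text \<open>
  The proof looks at a set \<open>E\<close> that maximises the ratio \<open>A\<close> of the energy of \<open>\<nu> = \<mu>|E\<close> to
  \<open>\<mu>(E)\<close>, and bounds \<open>A\<close> by a multiple of \<open>C\<close>. Write \<open>V(R)\<close> for the potential of \<open>\<nu>\<close> at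
  \<open>R\<close>, the sum of \<open>\<nu>(R')\<close> over \<open>R' \<supseteq> R\<close>, so that the energy is \<open>\<integral> V d\<nu>\<close>, and split the energy at the
  level \<open>\<delta> = c A\<close> of \<open>V\<close>, for a small absolute constant \<open>c\<close>.

  Rectangles with \<open>V(R) > \<delta>\<close> are contained in the union of the squares of
  \<open>G = {\<omega>. V(\<omega>) > \<delta>}\<close>, since \<open>V\<close> increases towards smaller rectangles; the Carleson condition
  for \<open>G\<close> bounds their part by \<open>C \<mu>(G)\<close>. Maximality of \<open>A\<close> controls \<open>\<mu>(G)\<close>: the
  energies of \<open>\<mu>|G\<close> and \<open>\<nu>\<close> are at most \<open>A \<mu>(G)\<close> and \<open>A \<mu>(E)\<close>, and \<open>\<delta> \<mu>(G)\<close> is at most their mutual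
  energy \<open>\<integral> V d(\<mu>|G)\<close>, whence \<open>\<mu>(G) \<le> \<mu>(E) / c\<^sup>2\<close>.

  Rectangles with \<open>V(R) \<le> \<delta>\<close> are the real difficulty (\<open>small_potential_energy_le\<close>). Their part of the
  energy is \<open>\<integral> S d\<nu>\<close>, where \<open>S\<close> sums \<open>\<nu>(R')\<close> only over those \<open>R' \<supseteq> R\<close> that have \<open>V(R') \<le> \<delta>\<close>. On a
  single tree \<open>S \<le> \<delta>\<close>, because the ancestors of a leaf form a chain; on the bi-tree this maximum
  principle fails. It is replaced by the observation that two rectangles containing a
  common square are either nested or cross. In \<open>S\<^sup>2\<close>, nested pairs contribute at most \<open>2 \<delta> S\<close>, while
  a crossing pair is determined by its intersection together with a horizontal and a vertical
  extension, and contributes a term of \<open>u w\<close>, the product of the one-parameter sums. Where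
  \<open>S\<close> is much larger than \<open>\<delta>\<close> this gives \<open>S \<le> \<kappa> + 8 I h\<close>, with \<open>I h\<close> the sum of
  \<open>h = u w / (S + \<kappa>)\<close> over all containing rectangles and \<open>\<kappa> = K \<delta>\<close> (\<open>S_le_threshold_plus\<close>).
  Two applications of the one-parameter structure show that the \<open>l\<^sup>2\<close> norm of \<open>h\<close> squared
  is at most \<open>2 / K\<close> times the energy (\<open>sum_majorant_square_le\<close>). So the part of small potential is at most
  \<open>K \<delta> |\<nu>|\<close> plus a small fraction of the energy. For \<open>\<delta> = c A\<close> and \<open>c\<close> small both terms are small
  multiples of the energy \<open>A |\<nu>|\<close>, and are absorbed.

  All these estimates rest only on the fact that the ancestors of each node form a chain, so they are
  carried out in an arbitrary finite forest. The geometry of intervals enters when the forest is the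
  dyadic tree: overlapping dyadic intervals are nested, and each is the union of its leaves.
\<close>

section \<open>Chains in a finite forest\<close>

text \<open>
  Smaller elements lie further from the roots, as for intervals under inclusion. The leaves \<open>L\<close> are
  the nodes that may carry mass; they need not be minimal.
\<close>
locale finite_forest =
  fixes T L :: "'a::order set"
  assumes finite_T: "finite T"
    and L_subset: "L \<subseteq> T"
    and comparable_above:
      "\<lbrakk>x \<in> T; b \<in> T; b' \<in> T; x \<le> b; x \<le> b'\<rbrakk> \<Longrightarrow> b \<le> b' \<or> b' \<le> b"
begin

definition above :: "'a \<Rightarrow> 'a set" where
  "above x = {b \<in> T. x \<le> b}"

definition leaves_below :: "'a \<Rightarrow> 'a set" where
  "leaves_below x = {s \<in> L. s \<le> x}"

lemma finite_L: "finite L"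
  using L_subset finite_T by (rule finite_subset)

lemma finite_above [simp]: "finite (above x)"
  by (simp add: above_def finite_T)

lemma finite_leaves_below [simp]: "finite (leaves_below x)"
  by (simp add: leaves_below_def finite_L)

lemma above_mono: "x \<le> b \<Longrightarrow> above b \<subseteq> above x"
  by (auto simp: above_def)

lemma self_in_above: "x \<in> T \<Longrightarrow> x \<in> above x"
  by (simp add: above_def)

text \<open>
  Induction from the roots down: the strict ancestors of \<open>x\<close> form a chain, and its smallest element is
  the parent \<open>p\<close>.
\<close>
lemma above_induct [consumes 1, case_names root child]:
  assumes "x \<in> T"
    and root: "\<And>x. x \<in> T \<Longrightarrow> above x = {x} \<Longrightarrow> P x"
    and child: "\<And>x p. x \<in> T \<Longrightarrow> p \<in> T \<Longrightarrow> above x = insert x (above p) \<Longrightarrow>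
                  x \<notin> above p \<Longrightarrow> P p \<Longrightarrow> P x"
  shows "P x"
  using \<open>x \<in> T\<close>
proof (induction "card (above x)" arbitrary: x rule: less_induct)
  case less
  show ?case
  proof (cases "above x - {x} = {}")
    case True
    then have "above x = {x}" using self_in_above[OF less.prems] by auto
    with less.prems show ?thesis by (rule root)
  next
    case False
    then obtain p where p: "p \<in> above x - {x}"
      and least: "\<And>b. b \<in> above x - {x} \<Longrightarrow> b \<le> p \<Longrightarrow> b = p"
      using finite_has_minimal[of "above x - {x}"] by auto
    have pT: "p \<in> T" and xp: "x \<le> p" "x \<noteq> p" using p by (auto simp: above_def)
    have "above x = insert x (above p)"
      using comparable_above[OF less.prems pT _ xp(1)] least less.prems pT xp
      by (auto simp: above_def)
    moreover have notin: "x \<notin> above p" using xp by (auto simp: above_def)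
    moreover from calculation have "card (above p) < card (above x)" by simp
    then have "P p" using pT by (rule less.hyps)
    ultimately show ?thesis using less.prems pT child by blast
  qed
qed

text \<open>
  A product of two sums over a chain is a double sum over pairs, and any two elements of the chain are
  comparable; the diagonal is counted twice.
\<close>
lemma sum_above_product_le:
  fixes g h :: "'a \<Rightarrow> real"
  assumes "x \<in> T" and "\<And>b. b \<in> T \<Longrightarrow> 0 \<le> g b" and "\<And>b. b \<in> T \<Longrightarrow> 0 \<le> h b"
  shows "sum g (above x) * sum h (above x) \<le>
         (\<Sum>b\<in>above x. g b * sum h (above b)) + (\<Sum>b\<in>above x. h b * sum g (above b))"
  using assms(1)
proof (induction x rule: above_induct)
  case (root x)
  then show ?case using assms(2,3)[of x] by (simp add: algebra_simps)
next
  case (child x p)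
  have "0 \<le> g x * h x" using assms(2,3) child(1) by simp
  with child(3-5) show ?case by (simp add: algebra_simps)
qed

text \<open>
  This is the discrete form of \<open>\<integral> dt / (t + \<kappa>)\<^sup>2 \<le> 1 / \<kappa>\<close>: going down the chain, \<open>G = sum g (above b)\<close>
  increases by \<open>g b\<close>, and each term is at most the decrease of \<open>1 / (G + \<kappa>)\<close>.
\<close>
lemma sum_above_weight_le:
  fixes g :: "'a \<Rightarrow> real"
  assumes "x \<in> T" and g: "\<And>b. b \<in> T \<Longrightarrow> 0 \<le> g b" and \<kappa>: "0 < \<kappa>"
  shows "(\<Sum>b\<in>above x. g b / (sum g (above b) + \<kappa>)\<^sup>2) \<le> 1 / \<kappa>"
proof -
  have nonneg: "0 \<le> sum g (above b)" for b
    using g by (auto intro!: sum_nonneg simp: above_def)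
  have step: "c / (c + d)\<^sup>2 \<le> 1 / d - 1 / (c + d)" if "0 \<le> c" "0 < d" for c d :: real
  proof -
    have "1 / d - 1 / (c + d) = c / (d * (c + d))" using that by (simp add: field_simps)
    moreover have "c / (c + d)\<^sup>2 \<le> c / (d * (c + d))"
      unfolding power2_eq_square using that by (intro divide_left_mono mult_right_mono) auto
    ultimately show ?thesis by simp
  qed
  have "(\<Sum>b\<in>above x. g b / (sum g (above b) + \<kappa>)\<^sup>2) \<le> 1 / \<kappa> - 1 / (sum g (above x) + \<kappa>)"
    using assms(1)
  proof (induction x rule: above_induct)
    case (root x)
    then show ?case using step[of "g x" \<kappa>] g \<kappa> by simp
  next
    case (child x p)
    have "g x / (g x + (sum g (above p) + \<kappa>))\<^sup>2
        \<le> 1 / (sum g (above p) + \<kappa>) - 1 / (g x + (sum g (above p) + \<kappa>))"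
      using step[of "g x" "sum g (above p) + \<kappa>"] g child(1) nonneg[of p] \<kappa> by simp
    with child(3-5) show ?case by (simp add: add.assoc)
  qed
  also have "\<dots> \<le> 1 / \<kappa>" using nonneg[of x] \<kappa> by simp
  finally show ?thesis .
qed

definition mass :: "('a \<times> 'a \<Rightarrow> real) \<Rightarrow> 'a \<Rightarrow> 'a \<Rightarrow> real" where
  "mass \<nu> x y = (\<Sum>s\<in>leaves_below x. \<Sum>t\<in>leaves_below y. \<nu> (s, t))"

definition potential :: "('a \<times> 'a \<Rightarrow> real) \<Rightarrow> 'a \<Rightarrow> 'a \<Rightarrow> real" where
  "potential \<nu> x y = (\<Sum>b\<in>above x. \<Sum>a\<in>above y. mass \<nu> b a)"

lemma sum_leaves_sum_above:
  "(\<Sum>s\<in>L. \<Sum>b\<in>above s. h s b) = (\<Sum>b\<in>T. \<Sum>s\<in>leaves_below b. h s b)"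
  for h :: "'a \<Rightarrow> 'a \<Rightarrow> real"
  unfolding above_def leaves_below_def using finite_L finite_T by (rule sum.swap_restrict)

lemma sum_above_swap:
  "(\<Sum>x\<in>T. \<Sum>b\<in>above x. h x b) = (\<Sum>b\<in>T. \<Sum>x | x \<in> T \<and> x \<le> b. h x b)"
  for h :: "'a \<Rightarrow> 'a \<Rightarrow> real"
  unfolding above_def using finite_T finite_T by (rule sum.swap_restrict)

text \<open>
  The summation operator over ancestors and the mass operator are adjoint. This is how integrals
  against a measure become sums over the bi-tree.
\<close>
lemma integral_of_sum_above:
  "(\<Sum>s\<in>L. \<Sum>t\<in>L. \<nu> (s, t) * (\<Sum>b\<in>above s. \<Sum>a\<in>above t. g b a))
     = (\<Sum>b\<in>T. \<Sum>a\<in>T. mass \<nu> b a * g b a)" for g :: "'a \<Rightarrow> 'a \<Rightarrow> real"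
proof -
  have "(\<Sum>s\<in>L. \<Sum>t\<in>L. \<nu> (s, t) * (\<Sum>b\<in>above s. \<Sum>a\<in>above t. g b a))
      = (\<Sum>s\<in>L. \<Sum>t\<in>L. \<Sum>b\<in>above s. \<Sum>a\<in>above t. \<nu> (s, t) * g b a)"
    by (simp add: sum_distrib_left)
  also have "\<dots> = (\<Sum>s\<in>L. \<Sum>b\<in>above s. \<Sum>t\<in>L. \<Sum>a\<in>above t. \<nu> (s, t) * g b a)"
    by (intro sum.cong refl sum.swap)
  also have "\<dots> = (\<Sum>b\<in>T. \<Sum>s\<in>leaves_below b. \<Sum>a\<in>T. \<Sum>t\<in>leaves_below a. \<nu> (s, t) * g b a)"
    by (simp add: sum_leaves_sum_above)
  also have "\<dots> = (\<Sum>b\<in>T. \<Sum>a\<in>T. \<Sum>s\<in>leaves_below b. \<Sum>t\<in>leaves_below a. \<nu> (s, t) * g b a)"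
    by (intro sum.cong refl sum.swap)
  also have "\<dots> = (\<Sum>b\<in>T. \<Sum>a\<in>T. mass \<nu> b a * g b a)"
    by (simp add: mass_def sum_distrib_right)
  finally show ?thesis .
qed

end

section \<open>The energy carried by small potentials\<close>

text \<open>
  In this section \<open>f\<close> is the mass of rectangles, \<open>V\<close> their potential, and \<open>F\<close> the mass cut off to potentials
  at most \<open>\<delta>\<close>. The sums of \<open>F\<close> over ancestors are taken in the first variable for \<open>u\<close>, in the second for
  \<open>w\<close>, and in both for \<open>S\<close>.
\<close>
locale bitree_measure = finite_forest T L for T L :: "'a::order set" +
  fixes \<nu> :: "'a \<times> 'a \<Rightarrow> real" and \<delta> :: real
  assumes nonneg: "\<lbrakk>s \<in> L; t \<in> L\<rbrakk> \<Longrightarrow> 0 \<le> \<nu> (s, t)"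
    and \<delta>_pos: "0 < \<delta>"
begin

abbreviation f :: "'a \<Rightarrow> 'a \<Rightarrow> real" where "f \<equiv> mass \<nu>"
abbreviation V :: "'a \<Rightarrow> 'a \<Rightarrow> real" where "V \<equiv> potential \<nu>"

definition F :: "'a \<Rightarrow> 'a \<Rightarrow> real" where
  "F x y = (if V x y \<le> \<delta> then f x y else 0)"

definition u :: "'a \<Rightarrow> 'a \<Rightarrow> real" where
  "u x y = (\<Sum>b\<in>above x. F b y)"

definition w :: "'a \<Rightarrow> 'a \<Rightarrow> real" where
  "w x y = (\<Sum>a\<in>above y. F x a)"

definition S :: "'a \<Rightarrow> 'a \<Rightarrow> real" where
  "S x y = (\<Sum>b\<in>above x. w b y)"

lemma mass_nonneg: "0 \<le> f x y"
  unfolding mass_def by (intro sum_nonneg nonneg) (auto simp: leaves_below_def)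

lemma potential_antimono: "x \<le> b \<Longrightarrow> y \<le> a \<Longrightarrow> V b a \<le> V x y"
proof -
  assume "x \<le> b" "y \<le> a"
  have "V b a \<le> V b y"
    unfolding potential_def using \<open>y \<le> a\<close>
    by (intro sum_mono sum_mono2 above_mono mass_nonneg) auto
  also have "\<dots> \<le> V x y"
    unfolding potential_def using \<open>x \<le> b\<close>
    by (intro sum_mono2 above_mono sum_nonneg mass_nonneg) auto
  finally show ?thesis .
qed

lemma F_nonneg: "0 \<le> F x y" and F_le_mass: "F x y \<le> f x y"
  by (auto simp: F_def mass_nonneg)

lemma u_nonneg: "0 \<le> u x y" and w_nonneg: "0 \<le> w x y" and S_nonneg: "0 \<le> S x y"
  by (simp_all add: u_def w_def S_def sum_nonneg F_nonneg)

lemma S_le_potential: "S x y \<le> V x y"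
  unfolding S_def w_def potential_def by (intro sum_mono F_le_mass)

lemma S_antimono: "x \<le> b \<Longrightarrow> y \<le> a \<Longrightarrow> S b a \<le> S x y"
proof -
  assume "x \<le> b" "y \<le> a"
  have "S b a \<le> (\<Sum>b'\<in>above b. w b' y)"
    unfolding S_def w_def using \<open>y \<le> a\<close> by (intro sum_mono sum_mono2 above_mono F_nonneg) auto
  also have "\<dots> \<le> S x y"
    unfolding S_def using \<open>x \<le> b\<close> by (intro sum_mono2 above_mono w_nonneg) auto
  finally show ?thesis .
qed

text \<open>
  The one-dimensional splitting into comparable pairs is applied in each variable. Pairs ordered the same
  way in both variables are nested: the smaller one, if it contributes to \<open>F\<close>, has \<open>S \<le> V \<le> \<delta>\<close>.
  Pairs ordered in opposite ways cross, and are collected at their meet, where they give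
  \<open>u\<close> times \<open>w\<close>.
\<close>
lemma S_square_le:
  assumes x: "x \<in> T" and y: "y \<in> T"
  shows "(S x y)\<^sup>2 \<le> 2 * \<delta> * S x y + 2 * (\<Sum>b\<in>above x. \<Sum>a\<in>above y. u b a * w b a)"
proof -
  have "(S x y)\<^sup>2 \<le> 2 * (\<Sum>b\<in>above x. w b y * S b y)"
    unfolding power2_eq_square S_def
    using sum_above_product_le[OF x, of "\<lambda>b. w b y" "\<lambda>b. w b y"] by (simp add: w_nonneg)
  also have "(\<Sum>b\<in>above x. w b y * S b y) = (\<Sum>b\<in>above x. \<Sum>b'\<in>above b. w b y * w b' y)"
    by (simp add: S_def sum_distrib_left)
  also have "\<dots> \<le> (\<Sum>b\<in>above x. \<Sum>b'\<in>above b.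
      (\<Sum>a\<in>above y. F b a * w b' a) + (\<Sum>a\<in>above y. F b' a * w b a))"
    unfolding w_def by (intro sum_mono sum_above_product_le y F_nonneg)
  also have "\<dots> = (\<Sum>b\<in>above x. \<Sum>b'\<in>above b. \<Sum>a\<in>above y. F b a * w b' a)
                + (\<Sum>b\<in>above x. \<Sum>b'\<in>above b. \<Sum>a\<in>above y. F b' a * w b a)"
    by (simp add: sum.distrib)
  also have "(\<Sum>b\<in>above x. \<Sum>b'\<in>above b. \<Sum>a\<in>above y. F b a * w b' a)
           = (\<Sum>b\<in>above x. \<Sum>a\<in>above y. F b a * S b a)"
    unfolding S_def sum_distrib_left by (intro sum.cong refl sum.swap)
  also have "(\<Sum>b\<in>above x. \<Sum>b'\<in>above b. \<Sum>a\<in>above y. F b' a * w b a)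
           = (\<Sum>b\<in>above x. \<Sum>a\<in>above y. u b a * w b a)"
    unfolding u_def sum_distrib_right by (intro sum.cong refl sum.swap)
  also have "(\<Sum>b\<in>above x. \<Sum>a\<in>above y. F b a * S b a) \<le> (\<Sum>b\<in>above x. \<Sum>a\<in>above y. F b a * \<delta>)"
  proof (intro sum_mono)
    fix b a
    show "F b a * S b a \<le> F b a * \<delta>"
    proof (cases "V b a \<le> \<delta>")
      case True
      then show ?thesis using S_le_potential[of b a] by (intro mult_left_mono F_nonneg) simp
    qed (simp add: F_def)
  qed
  also have "\<dots> = \<delta> * S x y"
    unfolding S_def w_def by (simp add: sum_distrib_left mult.commute)
  finally show ?thesis by simp
qed

text \<open>
  If \<open>S x y > \<kappa> \<ge> 4 \<delta>\<close>, the term \<open>2 \<delta> S\<close> of the previous bound is at most half of \<open>S\<^sup>2\<close>, so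
  \<open>S\<^sup>2\<close> is at most four times the crossing sum. Dividing by \<open>S x y\<close> is no worse than dividing each term
  by \<open>(S b a + \<kappa>) / 2\<close>, as \<open>S\<close> is largest at \<open>(x, y)\<close>. Keeping the weight \<open>1 / (S b a + \<kappa>)\<close> inside the
  sum is what makes the majorant small in \<open>l\<^sup>2\<close>.
\<close>
lemma S_le_threshold_plus:
  assumes x: "x \<in> T" and y: "y \<in> T" and \<kappa>: "4 * \<delta> \<le> \<kappa>"
  shows "S x y \<le> \<kappa> + 8 * (\<Sum>b\<in>above x. \<Sum>a\<in>above y. u b a * w b a / (S b a + \<kappa>))"
    (is "_ \<le> _ + 8 * ?P")
proof -
  have \<kappa>0: "0 < \<kappa>" using \<kappa> \<delta>_pos by linarith
  have P0: "0 \<le> ?P"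
    using \<kappa>0 by (intro sum_nonneg divide_nonneg_pos mult_nonneg_nonneg u_nonneg w_nonneg)
      (simp add: add_nonneg_pos S_nonneg)
  show ?thesis
  proof (cases "S x y \<le> \<kappa>")
    case False
    have term_le: "u b a * w b a \<le> 2 * S x y * (u b a * w b a / (S b a + \<kappa>))"
      if "b \<in> above x" "a \<in> above y" for b a
    proof -
      have pos: "0 < S b a + \<kappa>" using S_nonneg \<kappa>0 by (simp add: add_nonneg_pos)
      have "S b a + \<kappa> \<le> 2 * S x y"
        using that S_antimono[of x b y a] False by (simp add: above_def)
      then have "(u b a * w b a) * (S b a + \<kappa>) \<le> (u b a * w b a) * (2 * S x y)"
        by (intro mult_left_mono mult_nonneg_nonneg u_nonneg w_nonneg)
      with pos show ?thesis by (simp add: field_simps)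
    qed
    have "(\<Sum>b\<in>above x. \<Sum>a\<in>above y. u b a * w b a) \<le> 2 * S x y * ?P"
      unfolding sum_distrib_left by (intro sum_mono term_le)
    moreover have "2 * \<delta> * S x y \<le> (S x y)\<^sup>2 / 2"
    proof -
      have "4 * \<delta> * S x y \<le> S x y * S x y"
        using False \<kappa> by (intro mult_right_mono S_nonneg) linarith
      then show ?thesis by (simp add: power2_eq_square)
    qed
    ultimately have "S x y * S x y \<le> S x y * (8 * ?P)"
      using S_square_le[OF x y] by (simp add: power2_eq_square)
    moreover have "0 < S x y" using False \<kappa>0 by linarith
    ultimately have "S x y \<le> 8 * ?P" by simp
    then show ?thesis using \<kappa>0 by linarith
  qed (use P0 in linarith)
qed

text \<open>
  For fixed \<open>a\<close>, the mass \<open>f x a\<close> is a measure on leaves evaluated below \<open>x\<close>; exchanging the sums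
  turns a weighted sum over the descendants of \<open>b\<close> into an integral of sums of the weight along chains.
  The cut-off is harmless because potentials grow downwards: if \<open>F b a\<close> is cut off, so is every \<open>F x a\<close>
  below it.
\<close>
lemma sum_F_below_le:
  assumes k: "\<And>x. x \<in> T \<Longrightarrow> 0 \<le> k x"
    and M: "\<And>s. s \<in> L \<Longrightarrow> sum k (above s) \<le> M"
    and b: "b \<in> T"
  shows "(\<Sum>x | x \<in> T \<and> x \<le> b. F x a * k x) \<le> M * F b a"
proof (cases "V b a \<le> \<delta>")
  case False
  have "F x a = 0" if "x \<le> b" for x
    using potential_antimono[OF that order_refl, of a] False by (simp add: F_def)
  then show ?thesis using False by (simp add: F_def)
next
  case True
  define q where "q s = (\<Sum>t\<in>leaves_below a. \<nu> (s, t))" for s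
  have q: "0 \<le> q s" if "s \<in> L" for s
    unfolding q_def using that by (intro sum_nonneg nonneg) (auto simp: leaves_below_def)
  have fin: "finite {x \<in> T. x \<le> b}" using finite_T by simp
  have "(\<Sum>x | x \<in> T \<and> x \<le> b. F x a * k x) \<le> (\<Sum>x\<in>{x \<in> T. x \<le> b}. f x a * k x)"
    by (intro sum_mono mult_right_mono F_le_mass k) auto
  also have "\<dots> = (\<Sum>x\<in>{x \<in> T. x \<le> b}. \<Sum>s\<in>{s \<in> leaves_below b. s \<le> x}. q s * k x)"
    unfolding mass_def q_def[symmetric] sum_distrib_right
    by (intro sum.cong refl) (auto simp: leaves_below_def)
  also have "\<dots> = (\<Sum>s\<in>leaves_below b. \<Sum>x\<in>{x \<in> {x \<in> T. x \<le> b}. s \<le> x}. q s * k x)"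
    by (rule sum.swap_restrict[OF fin finite_leaves_below])
  also have "\<dots> = (\<Sum>s\<in>leaves_below b. q s * sum k {x \<in> {x \<in> T. x \<le> b}. s \<le> x})"
    by (simp add: sum_distrib_left)
  also have "\<dots> \<le> (\<Sum>s\<in>leaves_below b. q s * M)"
  proof (intro sum_mono mult_left_mono)
    fix s assume "s \<in> leaves_below b"
    then have s: "s \<in> L" by (simp add: leaves_below_def)
    have "sum k {x \<in> {x \<in> T. x \<le> b}. s \<le> x} \<le> sum k (above s)"
      by (intro sum_mono2) (auto simp: above_def finite_T intro: k)
    also have "\<dots> \<le> M" using s by (rule M)
    finally show "sum k {x \<in> {x \<in> T. x \<le> b}. s \<le> x} \<le> M" .
    show "0 \<le> q s" using s by (rule q)
  qed
  also have "\<dots> = M * F b a"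
    using True by (simp add: F_def mass_def q_def sum_distrib_left mult.commute)
  finally show ?thesis .
qed

text \<open>
  In one variable the maximum principle does hold: the ancestors \<open>b\<close> of \<open>x\<close> with \<open>V b y \<le> \<delta>\<close> are those above
  the lowest such \<open>b\<close>, where the sum is \<open>S b y \<le> V b y \<le> \<delta>\<close>.
\<close>
lemma sum_small_w_le:
  assumes "x \<in> T"
  shows "(\<Sum>b\<in>above x. if V b y \<le> \<delta> then w b y else 0) \<le> \<delta>"
  using assms
proof (induction x rule: above_induct)
  case (root x)
  have "w x y \<le> \<delta>" if "V x y \<le> \<delta>"
    using S_le_potential[of x y] that by (simp add: S_def root.hyps(2))
  then show ?case using \<delta>_pos unfolding root.hyps(2) by simp
next
  case (child x p)
  show ?case
  proof (cases "V x y \<le> \<delta>")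
    case True
    have "(\<Sum>b\<in>above x. if V b y \<le> \<delta> then w b y else 0) \<le> S x y"
      unfolding S_def by (intro sum_mono) (simp add: w_nonneg)
    also have "\<dots> \<le> \<delta>" using S_le_potential[of x y] True by linarith
    finally show ?thesis .
  qed (use child in simp)
qed

text \<open>
  Expand \<open>u x y\<close> as a sum over \<open>b \<ge> x\<close>. For fixed \<open>b\<close>, summing \<open>F x y * w x y\<close> over \<open>x \<le> b\<close> costs only the
  factor \<open>\<delta>\<close>, since along chains the sums of \<open>w\<close> are at most \<open>\<delta>\<close> where \<open>F\<close> lives.
\<close>
lemma sum_F_u_w_le: "(\<Sum>y\<in>T. \<Sum>x\<in>T. F x y * u x y * w x y) \<le> \<delta> * (\<Sum>y\<in>T. \<Sum>x\<in>T. (F x y)\<^sup>2)"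
  unfolding sum_distrib_left
proof (rule sum_mono)
  fix y assume "y \<in> T"
  define k where "k x = (if V x y \<le> \<delta> then w x y else 0)" for x
  have Fk: "F x y * k x = F x y * w x y" for x by (simp add: F_def k_def)
  have "(\<Sum>x\<in>T. F x y * u x y * w x y) = (\<Sum>x\<in>T. \<Sum>b\<in>above x. F b y * (F x y * k x))"
    unfolding Fk u_def sum_distrib_left sum_distrib_right by (simp add: mult_ac)
  also have "\<dots> = (\<Sum>b\<in>T. F b y * (\<Sum>x | x \<in> T \<and> x \<le> b. F x y * k x))"
    unfolding sum_above_swap by (simp add: sum_distrib_left)
  also have "\<dots> \<le> (\<Sum>b\<in>T. F b y * (\<delta> * F b y))"
  proof (intro sum_mono mult_left_mono sum_F_below_le F_nonneg)
    show "0 \<le> k x" for x by (simp add: k_def w_nonneg)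
    show "sum k (above s) \<le> \<delta>" if "s \<in> L" for s
      unfolding k_def using that L_subset by (intro sum_small_w_le) auto
  qed
  also have "\<dots> = (\<Sum>x\<in>T. \<delta> * (F x y)\<^sup>2)" by (simp add: power2_eq_square mult_ac)
  finally show "(\<Sum>x\<in>T. F x y * u x y * w x y) \<le> (\<Sum>x\<in>T. \<delta> * (F x y)\<^sup>2)" .
qed

text \<open>
  Expand \<open>u\<^sup>2\<close> as a sum of \<open>F b y * u b y\<close> over \<open>b \<ge> x\<close> and sum \<open>w\<^sup>2 / (S + \<kappa>)\<^sup>2\<close> over \<open>x \<le> b\<close> first. For fixed \<open>y\<close> the
  function \<open>S\<close> is the sum of \<open>w\<close> along chains, so \<open>w / (S + \<kappa>)\<^sup>2\<close> has chain sums at most \<open>1 / \<kappa>\<close>, and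
  the remaining factor \<open>w\<close>, a sum of terms \<open>F x a\<close>, passes from \<open>x\<close> to \<open>b\<close>.
\<close>
lemma sum_majorant_square_le:
  assumes \<kappa>: "0 < \<kappa>"
  shows "(\<Sum>y\<in>T. \<Sum>x\<in>T. (u x y * w x y / (S x y + \<kappa>))\<^sup>2)
           \<le> 2 * \<delta> / \<kappa> * (\<Sum>y\<in>T. \<Sum>x\<in>T. (F x y)\<^sup>2)"
proof -
  have "(\<Sum>x\<in>T. (u x y * w x y / (S x y + \<kappa>))\<^sup>2) \<le> 2 / \<kappa> * (\<Sum>x\<in>T. F x y * u x y * w x y)"
    if "y \<in> T" for y
  proof -
    define k where "k x = w x y / (S x y + \<kappa>)\<^sup>2" for x
    have k: "0 \<le> k x" for x by (simp add: k_def w_nonneg)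
    have kM: "sum k (above s) \<le> 1 / \<kappa>" if "s \<in> L" for s
      unfolding k_def S_def using that L_subset \<kappa>
      by (intro sum_above_weight_le) (auto simp: w_nonneg)
    have wk: "(\<Sum>x | x \<in> T \<and> x \<le> b. w x y * k x) \<le> 1 / \<kappa> * w b y" if b: "b \<in> T" for b
    proof -
      have "(\<Sum>x | x \<in> T \<and> x \<le> b. w x y * k x)
          = (\<Sum>a\<in>above y. \<Sum>x | x \<in> T \<and> x \<le> b. F x a * k x)"
        unfolding w_def sum_distrib_right by (rule sum.swap)
      also have "\<dots> \<le> (\<Sum>a\<in>above y. 1 / \<kappa> * F b a)"
        by (intro sum_mono sum_F_below_le k kM b)
      finally show ?thesis by (simp add: w_def sum_distrib_left)
    qed
    have "(\<Sum>x\<in>T. (u x y * w x y / (S x y + \<kappa>))\<^sup>2) = (\<Sum>x\<in>T. u x y * u x y * (w x y * k x))"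
      by (simp add: k_def power2_eq_square mult_ac)
    also have "\<dots> \<le> (\<Sum>x\<in>T. 2 * (\<Sum>b\<in>above x. F b y * u b y) * (w x y * k x))"
    proof (intro sum_mono mult_right_mono mult_nonneg_nonneg w_nonneg k)
      fix x assume "x \<in> T"
      then show "u x y * u x y \<le> 2 * (\<Sum>b\<in>above x. F b y * u b y)"
        using sum_above_product_le[of x "\<lambda>b. F b y" "\<lambda>b. F b y"] by (simp add: F_nonneg u_def)
    qed
    also have "\<dots> = 2 * (\<Sum>x\<in>T. \<Sum>b\<in>above x. F b y * u b y * (w x y * k x))"
      by (simp add: sum_distrib_left sum_distrib_right mult.assoc)
    also have "\<dots> = 2 * (\<Sum>b\<in>T. F b y * u b y * (\<Sum>x | x \<in> T \<and> x \<le> b. w x y * k x))"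
      unfolding sum_above_swap by (simp add: sum_distrib_left)
    also have "\<dots> \<le> 2 * (\<Sum>b\<in>T. F b y * u b y * (1 / \<kappa> * w b y))"
      by (intro mult_left_mono sum_mono wk mult_nonneg_nonneg F_nonneg u_nonneg) auto
    also have "\<dots> = 2 / \<kappa> * (\<Sum>x\<in>T. F x y * u x y * w x y)"
      by (simp add: sum_distrib_left)
    finally show ?thesis .
  qed
  then have "(\<Sum>y\<in>T. \<Sum>x\<in>T. (u x y * w x y / (S x y + \<kappa>))\<^sup>2)
      \<le> 2 / \<kappa> * (\<Sum>y\<in>T. \<Sum>x\<in>T. F x y * u x y * w x y)"
    unfolding sum_distrib_left[of "2 / \<kappa>" _ T] by (rule sum_mono)
  also have "\<dots> \<le> 2 / \<kappa> * (\<delta> * (\<Sum>y\<in>T. \<Sum>x\<in>T. (F x y)\<^sup>2))"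
    using \<kappa> by (intro mult_left_mono sum_F_u_w_le) simp
  finally show ?thesis by simp
qed

text \<open>
  The left-hand side is the integral of \<open>S\<close>. The choice \<open>\<kappa> = 2048 * \<delta>\<close> makes the majorant \<open>h\<close> satisfy
  \<open>\<parallel>h\<parallel>\<^sup>2 \<le> E / 1024\<close>, so that \<open>8 f h \<le> f\<^sup>2 / 8 + 128 h\<^sup>2\<close> sums to at most a quarter of the energy \<open>E\<close>.
\<close>
theorem small_potential_energy_le:
  "(\<Sum>x\<in>T. \<Sum>y\<in>T. if potential \<nu> x y \<le> \<delta> then (mass \<nu> x y)\<^sup>2 else 0)
     \<le> 2048 * \<delta> * (\<Sum>s\<in>L. \<Sum>t\<in>L. \<nu> (s, t)) + (\<Sum>x\<in>T. \<Sum>y\<in>T. (mass \<nu> x y)\<^sup>2) / 4"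
proof -
  define \<kappa> where "\<kappa> = 2048 * \<delta>"
  have \<kappa>: "0 < \<kappa>" "4 * \<delta> \<le> \<kappa>" using \<delta>_pos by (auto simp: \<kappa>_def)
  define h where "h x y = u x y * w x y / (S x y + \<kappa>)" for x y
  define E where "E = (\<Sum>x\<in>T. \<Sum>y\<in>T. (f x y)\<^sup>2)"
  have h2: "(\<Sum>x\<in>T. \<Sum>y\<in>T. (h x y)\<^sup>2) \<le> E / 1024"
  proof -
    have "(\<Sum>x\<in>T. \<Sum>y\<in>T. (h x y)\<^sup>2) = (\<Sum>y\<in>T. \<Sum>x\<in>T. (h x y)\<^sup>2)" by (rule sum.swap)
    also have "\<dots> \<le> 2 * \<delta> / \<kappa> * (\<Sum>y\<in>T. \<Sum>x\<in>T. (F x y)\<^sup>2)"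
      unfolding h_def using \<kappa>(1) by (rule sum_majorant_square_le)
    also have "2 * \<delta> / \<kappa> = 1 / 1024" using \<delta>_pos by (simp add: \<kappa>_def)
    also have "(\<Sum>y\<in>T. \<Sum>x\<in>T. (F x y)\<^sup>2) = (\<Sum>x\<in>T. \<Sum>y\<in>T. (F x y)\<^sup>2)" by (rule sum.swap)
    also have "1 / 1024 * \<dots> \<le> 1 / 1024 * E"
      unfolding E_def by (intro mult_left_mono sum_mono power_mono F_le_mass F_nonneg) auto
    finally show ?thesis by simp
  qed
  have "(\<Sum>x\<in>T. \<Sum>y\<in>T. if V x y \<le> \<delta> then (f x y)\<^sup>2 else 0) = (\<Sum>x\<in>T. \<Sum>y\<in>T. f x y * F x y)"
    by (intro sum.cong refl) (simp add: F_def power2_eq_square)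
  also have "\<dots> = (\<Sum>s\<in>L. \<Sum>t\<in>L. \<nu> (s, t) * S s t)"
    unfolding S_def w_def by (simp add: integral_of_sum_above)
  also have "\<dots> \<le> (\<Sum>s\<in>L. \<Sum>t\<in>L. \<nu> (s, t) * (\<kappa> + (\<Sum>b\<in>above s. \<Sum>a\<in>above t. 8 * h b a)))"
  proof (intro sum_mono mult_left_mono nonneg)
    fix s t assume "s \<in> L" "t \<in> L"
    then show "S s t \<le> \<kappa> + (\<Sum>b\<in>above s. \<Sum>a\<in>above t. 8 * h b a)"
      using S_le_threshold_plus[of s t \<kappa>] \<kappa> L_subset by (auto simp: h_def sum_distrib_left)
  qed
  also have "\<dots> = \<kappa> * (\<Sum>s\<in>L. \<Sum>t\<in>L. \<nu> (s, t)) + (\<Sum>x\<in>T. \<Sum>y\<in>T. f x y * (8 * h x y))"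
    unfolding integral_of_sum_above[symmetric]
    by (simp add: sum.distrib sum_distrib_left distrib_left mult.commute)
  also have "(\<Sum>x\<in>T. \<Sum>y\<in>T. f x y * (8 * h x y)) \<le> (\<Sum>x\<in>T. \<Sum>y\<in>T. (f x y)\<^sup>2 / 8 + 128 * (h x y)\<^sup>2)"
  proof (intro sum_mono)
    fix x y
    have "0 \<le> (f x y - 32 * h x y)\<^sup>2" by simp
    then show "f x y * (8 * h x y) \<le> (f x y)\<^sup>2 / 8 + 128 * (h x y)\<^sup>2"
      by (simp add: power2_eq_square algebra_simps)
  qed
  also have "\<dots> = E / 8 + 128 * (\<Sum>x\<in>T. \<Sum>y\<in>T. (h x y)\<^sup>2)"
    by (simp add: E_def sum.distrib sum_distrib_left sum_divide_distrib)
  finally show ?thesis using h2 by (simp add: \<kappa>_def E_def)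
qed

end


section \<open>A set of extremal energy\<close>

text \<open>
  In the extremal set \<open>H\<close> the energy equals \<open>A\<close> times the mass, so the threshold \<open>\<delta> = A / 8192\<close> makes the
  linear term \<open>2048 * \<delta> * \<mu>(H)\<close> of the small-potential bound another quarter of the energy.
\<close>
theorem (in finite_forest) carleson_imp_restricted_energy:
  fixes \<mu> :: "'a \<times> 'a \<Rightarrow> real"
  assumes masses_nonneg: "\<And>s t. \<lbrakk>s \<in> L; t \<in> L\<rbrakk> \<Longrightarrow> 0 \<le> \<mu> (s, t)"
    and C: "0 \<le> C"
    and carleson: "\<And>G. G \<subseteq> L \<times> L \<Longrightarrow>
      (\<Sum>x\<in>T. \<Sum>y\<in>T. if leaves_below x \<times> leaves_below y \<subseteq> G then (mass \<mu> x y)\<^sup>2 else 0)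
        \<le> C * sum \<mu> G"
    and "E \<subseteq> L \<times> L"
  shows "(\<Sum>x\<in>T. \<Sum>y\<in>T. (mass (\<lambda>p. if p \<in> E then \<mu> p else 0) x y)\<^sup>2) \<le> 2 * 8192\<^sup>2 * C * sum \<mu> E"
proof -
  define res where "res G = (\<lambda>p. if p \<in> G then \<mu> p else 0)" for G
  define en where "en G = (\<Sum>x\<in>T. \<Sum>y\<in>T. (mass (res G) x y)\<^sup>2)" for G
  \<comment> \<open>Sets of mass zero enter this maximum with ratio \<open>0\<close>; their energy vanishes as well.\<close>
  define A where "A = Max ((\<lambda>G. en G / sum \<mu> G) ` Pow (L \<times> L))"
  have fin: "finite (L \<times> L)" by (simp add: finite_L)
  have \<mu>_nonneg: "0 \<le> sum \<mu> G" if "G \<subseteq> L \<times> L" for G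
    using that masses_nonneg by (intro sum_nonneg) auto
  have total: "(\<Sum>s\<in>L. \<Sum>t\<in>L. res G (s, t)) = sum \<mu> G" if "G \<subseteq> L \<times> L" for G
  proof -
    have "(\<Sum>s\<in>L. \<Sum>t\<in>L. res G (s, t)) = sum (res G) (L \<times> L)"
      by (simp add: sum.cartesian_product)
    also have "\<dots> = sum \<mu> (L \<times> L \<inter> G)"
      unfolding res_def by (rule sum.inter_restrict[OF fin, symmetric])
    also have "L \<times> L \<inter> G = G" using that by blast
    finally show ?thesis .
  qed
  have en_le: "en G \<le> A * sum \<mu> G" if G: "G \<subseteq> L \<times> L" for G
  proof (cases "sum \<mu> G = 0")
    case True
    have "finite G" using G fin by (rule finite_subset)
    then have "\<forall>p\<in>G. \<mu> p = 0"
      using True G masses_nonneg by (subst sum_nonneg_eq_0_iff[symmetric]) auto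
    then have "mass (res G) x y = 0" for x y
      unfolding mass_def res_def by (intro sum.neutral ballI) auto
    then show ?thesis using True by (simp add: en_def)
  next
    case False
    have "en G / sum \<mu> G \<le> A"
      unfolding A_def using G fin by (intro Max_ge) auto
    moreover have "0 < sum \<mu> G" using False \<mu>_nonneg[OF G] by linarith
    ultimately show ?thesis by (simp add: field_simps)
  qed
  have "A \<le> 2 * 8192\<^sup>2 * C"
  proof (cases "A \<le> 0")
    case True
    then show ?thesis using C by (intro order_trans[OF True]) simp
  next
    case A_pos: False
    have "A \<in> (\<lambda>G. en G / sum \<mu> G) ` Pow (L \<times> L)"
      unfolding A_def using fin by (intro Max_in) auto
    then obtain H where H: "H \<subseteq> L \<times> L" and A_eq: "A = en H / sum \<mu> H" by auto
    have "sum \<mu> H \<noteq> 0" using A_pos A_eq by auto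
    then have H_pos: "0 < sum \<mu> H" and en_H: "en H = A * sum \<mu> H"
      using \<mu>_nonneg[OF H] A_eq by auto
    define \<delta> where "\<delta> = A / 8192"
    interpret bitree_measure T L "res H" \<delta>
      using A_pos masses_nonneg by unfold_locales (auto simp: \<delta>_def res_def)
    define G where "G = {(s, t) \<in> L \<times> L. \<delta> < V s t}"
    have G: "G \<subseteq> L \<times> L" by (auto simp: G_def)
    have "(\<Sum>x\<in>T. \<Sum>y\<in>T. if V x y \<le> \<delta> then 0 else (f x y)\<^sup>2)
        \<le> (\<Sum>x\<in>T. \<Sum>y\<in>T. if leaves_below x \<times> leaves_below y \<subseteq> G then (mass \<mu> x y)\<^sup>2 else 0)"
    proof (intro sum_mono)
      fix x y
      have "f x y \<le> mass \<mu> x y"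
        unfolding mass_def res_def using masses_nonneg by (intro sum_mono) (auto simp: leaves_below_def)
      then have "(f x y)\<^sup>2 \<le> (mass \<mu> x y)\<^sup>2" by (intro power_mono mass_nonneg)
      moreover have "leaves_below x \<times> leaves_below y \<subseteq> G" if "\<delta> < V x y"
        using that by (auto simp: G_def leaves_below_def intro: less_le_trans potential_antimono)
      ultimately show "(if V x y \<le> \<delta> then 0 else (f x y)\<^sup>2)
          \<le> (if leaves_below x \<times> leaves_below y \<subseteq> G then (mass \<mu> x y)\<^sup>2 else 0)"
        by auto
    qed
    also have "\<dots> \<le> C * sum \<mu> G" using G by (rule carleson)
    finally have large: "(\<Sum>x\<in>T. \<Sum>y\<in>T. if V x y \<le> \<delta> then 0 else (f x y)\<^sup>2) \<le> C * sum \<mu> G" .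
    \<comment> \<open>The mutual energy of \<open>res G\<close> and \<open>res H\<close> is estimated by \<open>A\<close> times the masses. The weights in
      \<open>a b \<le> a\<^sup>2 / 16384 + 4096 b\<^sup>2\<close> leave exactly half of \<open>\<delta> * sum \<mu> G\<close> to be absorbed on the left.\<close>
    have "\<delta> * sum \<mu> G = (\<Sum>s\<in>L. \<Sum>t\<in>L. res G (s, t) * \<delta>)"
      unfolding total[OF G, symmetric] by (simp add: sum_distrib_left mult.commute)
    also have "\<dots> \<le> (\<Sum>s\<in>L. \<Sum>t\<in>L. res G (s, t) * V s t)"
      using masses_nonneg by (intro sum_mono) (auto simp: res_def G_def intro: mult_left_mono)
    also have "\<dots> = (\<Sum>x\<in>T. \<Sum>y\<in>T. mass (res G) x y * f x y)"
      unfolding potential_def by (rule integral_of_sum_above)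
    also have "\<dots> \<le> (\<Sum>x\<in>T. \<Sum>y\<in>T. (mass (res G) x y)\<^sup>2 / 16384 + 4096 * (f x y)\<^sup>2)"
    proof (intro sum_mono)
      fix x y
      have "0 \<le> (mass (res G) x y - 8192 * f x y)\<^sup>2" by simp
      then show "mass (res G) x y * f x y \<le> (mass (res G) x y)\<^sup>2 / 16384 + 4096 * (f x y)\<^sup>2"
        by (simp add: power2_eq_square algebra_simps)
    qed
    also have "\<dots> = en G / 16384 + 4096 * en H"
      by (simp add: en_def sum.distrib sum_distrib_left sum_divide_distrib)
    also have "\<dots> \<le> A * sum \<mu> G / 16384 + 4096 * (A * sum \<mu> H)"
      using en_le[OF G] en_le[OF H] by linarith
    finally have "A * sum \<mu> G \<le> A * (8192\<^sup>2 * sum \<mu> H)" by (simp add: \<delta>_def)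
    then have G_le: "sum \<mu> G \<le> 8192\<^sup>2 * sum \<mu> H" using A_pos by simp
    have "en H = (\<Sum>x\<in>T. \<Sum>y\<in>T. if V x y \<le> \<delta> then (f x y)\<^sup>2 else 0)
               + (\<Sum>x\<in>T. \<Sum>y\<in>T. if V x y \<le> \<delta> then 0 else (f x y)\<^sup>2)"
      unfolding en_def sum.distrib[symmetric] by (intro sum.cong refl) auto
    also have "\<dots> \<le> 2048 * \<delta> * sum \<mu> H + en H / 4 + C * sum \<mu> G"
      using small_potential_energy_le large by (simp add: total[OF H] en_def)
    also have "\<dots> \<le> 2048 * \<delta> * sum \<mu> H + en H / 4 + C * (8192\<^sup>2 * sum \<mu> H)"
      using G_le C by (intro add_left_mono mult_left_mono)
    finally have "A * sum \<mu> H \<le> 2 * 8192\<^sup>2 * C * sum \<mu> H"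
      unfolding en_H \<delta>_def by (simp add: algebra_simps)
    then show ?thesis using H_pos by simp
  qed
  then have "A * sum \<mu> E \<le> 2 * 8192\<^sup>2 * C * sum \<mu> E"
    using \<mu>_nonneg[OF \<open>E \<subseteq> L \<times> L\<close>] by (rule mult_right_mono)
  with en_le[OF \<open>E \<subseteq> L \<times> L\<close>] show ?thesis by (simp add: en_def res_def)
qed

section \<open>The dyadic bi-tree\<close>

text \<open>
  The hypotheses say that the interiors meet; closed intervals sharing only an endpoint need not be
  nested. On the grid of mesh \<open>2^-l\<close> all endpoints are integers, so the strict inequalities
  improve to the weak ones that inclusion requires.
\<close>
lemma dyadic_interval_nested:
  assumes "k \<le> l" and left: "real j / 2 ^ k < (real i + 1) / 2 ^ l"
    and right: "real i / 2 ^ l < (real j + 1) / 2 ^ k"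
  shows "dyadic_interval l i \<subseteq> dyadic_interval k j"
proof -
  define m where "m = (2::nat) ^ (l - k)"
  have m: "(2::real) ^ l = 2 ^ k * real m" and m0: "0 < real m"
    using \<open>k \<le> l\<close> by (simp_all add: m_def flip: power_add)
  have "real (j * m) < real (i + 1)"
    using left m0 unfolding m by (simp add: field_simps)
  then have l: "j * m \<le> i" by linarith
  have "real i < real ((j + 1) * m)"
    using right m0 unfolding m by (simp add: field_simps)
  then have r: "i + 1 \<le> (j + 1) * m" by linarith
  have "real (j * m) \<le> real i" "real (i + 1) \<le> real ((j + 1) * m)"
    using l r by (simp_all only: of_nat_le_iff)
  then have "real j * real m / 2 ^ l \<le> real i / 2 ^ l"
    "(real i + 1) / 2 ^ l \<le> (real j + 1) * real m / 2 ^ l"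
    by (simp_all add: divide_right_mono algebra_simps)
  then have "real j / 2 ^ k \<le> real i / 2 ^ l" "(real i + 1) / 2 ^ l \<le> (real j + 1) / 2 ^ k"
    using m0 unfolding m by simp_all
  then show ?thesis by (auto simp: dyadic_interval_def)
qed

lemma tree_boundary_subset: "tree_boundary N \<subseteq> dyadic_tree N"
  by (auto simp: tree_boundary_def dyadic_tree_def)

lemma dyadic_tree_nonempty: "I \<in> dyadic_tree N \<Longrightarrow> I \<noteq> {}"
  by (auto simp: dyadic_tree_def dyadic_interval_def divide_right_mono)

lemma finite_forest_dyadic: "finite_forest (dyadic_tree N) (tree_boundary N)"
proof
  fix x b b' :: "real set"
  assume "x \<in> dyadic_tree N" "b \<in> dyadic_tree N" "b' \<in> dyadic_tree N"
  then obtain k j l i l' i' where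
    x: "x = dyadic_interval k j" and b: "b = dyadic_interval l i" and b': "b' = dyadic_interval l' i'"
    unfolding dyadic_tree_def by blast
  assume "x \<le> b" "x \<le> b'"
  moreover have lt: "real j / 2 ^ k < (real j + 1) / 2 ^ k" by (simp add: divide_strict_right_mono)
  ultimately have
    "real i / 2 ^ l \<le> real j / 2 ^ k" "(real j + 1) / 2 ^ k \<le> (real i + 1) / 2 ^ l"
    "real i' / 2 ^ l' \<le> real j / 2 ^ k" "(real j + 1) / 2 ^ k \<le> (real i' + 1) / 2 ^ l'"
    unfolding x b b' dyadic_interval_def by auto
  with lt have "real i / 2 ^ l < (real i' + 1) / 2 ^ l'" "real i' / 2 ^ l' < (real i + 1) / 2 ^ l"
    by linarith+
  then show "b \<le> b' \<or> b' \<le> b"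
    unfolding b b' using dyadic_interval_nested nat_le_linear by metis
qed (simp_all add: finite_dyadic_tree tree_boundary_subset)

lemma dyadic_interval_halves:
  "dyadic_interval k j = dyadic_interval (Suc k) (2 * j) \<union> dyadic_interval (Suc k) (2 * j + 1)"
  by (auto simp: dyadic_interval_def field_simps)

text \<open>
  An interval is the union of the leaves below it. Hence a rectangle all of whose boundary squares
  belong to \<open>G\<close> is one of the rectangles inside \<open>G\<close>.
\<close>
lemma dyadic_tree_covered:
  assumes "I \<in> dyadic_tree N" "r \<in> I"
  obtains s where "s \<in> tree_boundary N" "r \<in> s" "s \<subseteq> I"
proof -
  have "\<exists>s\<in>tree_boundary N. r \<in> s \<and> s \<subseteq> dyadic_interval k j"
    if "k \<le> N" "j < 2 ^ k" "r \<in> dyadic_interval k j" for k j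
    using that
  proof (induction k arbitrary: j rule: inc_induct)
    case base
    then show ?case by (auto simp: tree_boundary_def)
  next
    case (step k)
    have "2 * j < 2 ^ Suc k" "2 * j + 1 < 2 ^ Suc k" using step.prems(1) by auto
    moreover have "r \<in> dyadic_interval (Suc k) (2 * j) \<or> r \<in> dyadic_interval (Suc k) (2 * j + 1)"
      using step.prems(2) by (simp only: dyadic_interval_halves[of k j] Un_iff)
    ultimately obtain i s where "s \<in> tree_boundary N" "r \<in> s" "s \<subseteq> dyadic_interval (Suc k) i"
      and "i = 2 * j \<or> i = 2 * j + 1"
      using step.IH[of "2 * j"] step.IH[of "2 * j + 1"] by blast
    moreover from this have "dyadic_interval (Suc k) i \<subseteq> dyadic_interval k j"
      unfolding dyadic_interval_halves[of k j] by blast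
    ultimately show ?case by blast
  qed
  then show ?thesis using assms that unfolding dyadic_tree_def by blast
qed

lemma inj_on_rectangle: "inj_on (\<lambda>(I, J). I \<times> J) (dyadic_tree N \<times> dyadic_tree N)"
  by (auto simp: inj_on_def times_eq_iff dest: dyadic_tree_nonempty)

lemma sum_bitree: "sum g (bitree N) = (\<Sum>I\<in>dyadic_tree N. \<Sum>J\<in>dyadic_tree N. g (I \<times> J))"
  for g :: "(real \<times> real) set \<Rightarrow> real"
proof -
  have "bitree N = (\<lambda>(I, J). I \<times> J) ` (dyadic_tree N \<times> dyadic_tree N)"
    by (auto simp: bitree_def)
  then have "sum g (bitree N) = (\<Sum>(I, J)\<in>dyadic_tree N \<times> dyadic_tree N. g (I \<times> J))"
    by (simp only: sum.reindex[OF inj_on_rectangle]) (simp add: case_prod_beta comp_def)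
  then show ?thesis by (simp add: sum.cartesian_product)
qed

lemma sum_squares:
  assumes "G \<subseteq> tree_boundary N \<times> tree_boundary N"
  shows "sum g ((\<lambda>(s, t). s \<times> t) ` G) = (\<Sum>(s, t)\<in>G. g (s \<times> t))"
proof -
  have "G \<subseteq> dyadic_tree N \<times> dyadic_tree N" using assms tree_boundary_subset[of N] by blast
  then show ?thesis
    by (simp only: sum.reindex[OF inj_on_subset[OF inj_on_rectangle]])
      (simp add: case_prod_beta comp_def)
qed

text \<open>
  Nonempty rectangles correspond to pairs of sides, and boundary squares to pairs of leaves; under
  this correspondence \<open>mass\<close> is \<open>rect_mass\<close>, and both conditions become those of the forest.
\<close>
theorem theorem1p12:
  fixes C :: real
  assumes "C > 0"
  shows "\<exists>C'>0. \<forall>N\<ge>1. \<forall>\<mu>. boundary_measure N \<mu> \<longrightarrow> carleson_condition N \<mu> C \<longrightarrow>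
           restricted_energy_condition N \<mu> C'"
proof (intro exI[of _ "2 * 8192\<^sup>2 * C"] conjI allI impI)
  show "0 < 2 * 8192\<^sup>2 * C" using assms by simp
  fix N :: nat and \<mu> :: "(real \<times> real) set \<Rightarrow> real"
  assume "boundary_measure N \<mu>" and car: "carleson_condition N \<mu> C"
  let ?T = "dyadic_tree N" and ?L = "tree_boundary N"
  let ?sq = "\<lambda>(s :: real set, t :: real set). s \<times> t"
  interpret finite_forest ?T ?L by (rule finite_forest_dyadic)
  have boundary: "bitree_boundary N = ?sq ` (?L \<times> ?L)" by (auto simp: bitree_boundary_def)
  have nonneg: "0 \<le> \<mu> (?sq (s, t))" if "s \<in> ?L" "t \<in> ?L" for s t
    using \<open>boundary_measure N \<mu>\<close> that unfolding boundary_measure_def boundary by auto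
  have rect_mass: "rect_mass N \<rho> (I \<times> J) = mass (\<lambda>p. \<rho> (?sq p)) I J" for \<rho> I J
  proof -
    have "{\<omega> \<in> bitree_boundary N. \<omega> \<subseteq> I \<times> J} = ?sq ` (leaves_below I \<times> leaves_below J)"
    proof -
      have "s \<times> t \<subseteq> I \<times> J \<longleftrightarrow> s \<subseteq> I \<and> t \<subseteq> J" if "s \<in> ?L" "t \<in> ?L" for s t
        using that L_subset dyadic_tree_nonempty[of s N] dyadic_tree_nonempty[of t N]
        by (auto simp: times_subset_iff)
      then show ?thesis unfolding boundary leaves_below_def by auto
    qed
    moreover have "leaves_below I \<times> leaves_below J \<subseteq> ?L \<times> ?L" by (auto simp: leaves_below_def)
    ultimately show ?thesis
      by (simp add: rect_mass_def sum_squares mass_def sum.cartesian_product)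
  qed
  show "restricted_energy_condition N \<mu> (2 * 8192\<^sup>2 * C)"
    unfolding restricted_energy_condition_def
  proof (intro allI impI)
    fix E assume "E \<subseteq> bitree_boundary N"
    define E' where "E' = {p \<in> ?L \<times> ?L. ?sq p \<in> E}"
    have E': "E' \<subseteq> ?L \<times> ?L" by (auto simp: E'_def)
    have E_eq: "E = ?sq ` E'" using \<open>E \<subseteq> bitree_boundary N\<close> by (auto simp: E'_def boundary)
    have carleson: "(\<Sum>x\<in>?T. \<Sum>y\<in>?T. if leaves_below x \<times> leaves_below y \<subseteq> G
        then (mass (\<lambda>p. \<mu> (?sq p)) x y)\<^sup>2 else 0) \<le> C * (\<Sum>p\<in>G. \<mu> (?sq p))"
      if G: "G \<subseteq> ?L \<times> ?L" for G
    proof -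
      have inside: "x \<times> y \<subseteq> \<Union> (?sq ` G)"
        if x: "x \<in> ?T" and y: "y \<in> ?T" and sub: "leaves_below x \<times> leaves_below y \<subseteq> G" for x y
      proof
        fix z assume "z \<in> x \<times> y"
        then obtain r q where z: "z = (r, q)" "r \<in> x" "q \<in> y" by auto
        obtain s where "s \<in> ?L" "r \<in> s" "s \<subseteq> x" using dyadic_tree_covered[OF x z(2)] .
        moreover obtain t where "t \<in> ?L" "q \<in> t" "t \<subseteq> y" using dyadic_tree_covered[OF y z(3)] .
        ultimately have "(s, t) \<in> G" "z \<in> ?sq (s, t)"
          using sub z(1) by (auto simp: leaves_below_def)
        then show "z \<in> \<Union> (?sq ` G)" by blast
      qed
      have "(\<Sum>x\<in>?T. \<Sum>y\<in>?T. if leaves_below x \<times> leaves_below y \<subseteq> G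
              then (mass (\<lambda>p. \<mu> (?sq p)) x y)\<^sup>2 else 0)
          \<le> (\<Sum>x\<in>?T. \<Sum>y\<in>?T. if x \<times> y \<subseteq> \<Union> (?sq ` G) then (rect_mass N \<mu> (x \<times> y))\<^sup>2 else 0)"
        using inside by (intro sum_mono) (auto simp: rect_mass)
      also have "\<dots> = (\<Sum>R\<in>rects_inside N (?sq ` G). (rect_mass N \<mu> R)\<^sup>2)"
        unfolding rects_inside_def sum.inter_filter[OF finite_bitree] sum_bitree ..
      also have "\<dots> \<le> C * sum \<mu> (?sq ` G)"
        using car image_mono[OF G, of ?sq] unfolding carleson_condition_def boundary by simp
      finally show ?thesis using sum_squares[OF G, of \<mu>] by (simp add: case_prod_beta)
    qed
    have "energy N (restrict_measure \<mu> E)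
        = (\<Sum>x\<in>?T. \<Sum>y\<in>?T. (mass (\<lambda>p. restrict_measure \<mu> E (?sq p)) x y)\<^sup>2)"
      by (simp only: energy_def sum_bitree rect_mass)
    also have "\<dots> = (\<Sum>x\<in>?T. \<Sum>y\<in>?T. (mass (\<lambda>p. if p \<in> E' then \<mu> (?sq p) else 0) x y)\<^sup>2)"
    proof -
      have "mass (\<lambda>p. restrict_measure \<mu> E (?sq p)) x y
          = mass (\<lambda>p. if p \<in> E' then \<mu> (?sq p) else 0) x y" for x y
        unfolding mass_def
        by (intro sum.cong refl) (auto simp: restrict_measure_def E'_def leaves_below_def)
      then show ?thesis by simp
    qed
    also have "\<dots> \<le> 2 * 8192\<^sup>2 * C * (\<Sum>p\<in>E'. \<mu> (?sq p))"
      using assms E' by (intro carleson_imp_restricted_energy nonneg carleson) auto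
    also have "(\<Sum>p\<in>E'. \<mu> (?sq p)) = sum \<mu> E"
      unfolding E_eq using sum_squares[OF E', of \<mu>] by (simp add: case_prod_beta)
    finally show "energy N (restrict_measure \<mu> E) \<le> 2 * 8192\<^sup>2 * C * sum \<mu> E" .
  qed
qed

end
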